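(* Let $p\in\{0,1,\ldots,6\}$. For each $\mathrm{k}\in\mathbb{N}^{p+1}$, there holds $V_{\mathrm{k}}(\boldsymbol{x})=\mathcal{P}_{\mathrm{k}}(\boldsymbol{x})$ for all $\boldsymbol{x}\in\mathbb{O}$.
   Context: $\mathbb{O}$ is the real, non-associative, alternative algebra of octonions with basis $e_0=1,e_1,\ldots,e_7$ and product $e_ie_j=-\delta_{ij}+\sum_k\epsilon_{ijk}e_k$ for $1\le i,j\le 7$, where $\epsilon_{ijk}$ is totally antisymmetric, equals $1$ on the triples $(1,2,3),(1,4,5),(2,4,6),(3,4,7),(5,3,6),(6,1,7),(7,2,5)$, and vanishes on triples that are not permutations of these. $\mathbb{N}=\{0,1,2,\ldots\}$. Fix $p\in\{0,\ldots,6\}$. $\mathbb{R}^{p+1}$ denotes the real span of $e_0,\ldots,e_p$, with elements $\boldsymbol{x}_p=\sum_{i=0}^px_ie_i$, and $\mathbb{S}=\{\sum_{i=p+1}^7x_ie_i:\sum_{i=p+1}^7x_i^2=1\}$. Every $\boldsymbol{x}\in\mathbb{O}$ is written $\boldsymbol{x}=\boldsymbol{x}_p+r\underline{\omega}$ with $\boldsymbol{x}_p\in\mathbb{R}^{p+1}$, $r\ge0$, $\underline{\omega}\in\mathbb{S}$. With $D_{\boldsymbol{x}_p}=\sum_{i=0}^pe_i\partial_{x_i}$ (acting by left multiplication) and $\Delta_{\boldsymbol{x}_p}=\sum_{i=0}^p\partial_{x_i}^2$, the CK-extension of a polynomial $f_0:\mathbb{R}^{p+1}\to\mathbb{O}$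 is $$CK[f_0](\boldsymbol{x}_p+r\underline{\omega})=\sum_{k=0}^{+\infty}\frac{r^{2k}}{(2k)!}(-\Delta_{\boldsymbol{x}_p})^kf_0(\boldsymbol{x}_p)+\underline{\omega}\sum_{k=0}^{+\infty}\frac{r^{2k+1}}{(2k+1)!}(-\Delta_{\boldsymbol{x}_p})^k\big(D_{\boldsymbol{x}_p}f_0(\boldsymbol{x}_p)\big).$$ For $\mathrm{k}=(k_0,\ldots,k_p)\in\mathbb{N}^{p+1}$, $V_{\mathrm{k}}=\frac{1}{\mathrm{k}!}CK[\boldsymbol{x}_p^{\mathrm{k}}]$, where $\boldsymbol{x}_p^{\mathrm{k}}=x_0^{k_0}\cdots x_p^{k_p}$ and $\mathrm{k}!=k_0!\cdots k_p!$. Fueter variables: $z_\ell(\boldsymbol{x}_p+r\underline{\omega})=x_\ell+r\,\underline{\omega}e_\ell$, $\ell=0,\ldots,p$. Fueter polynomials: for $\mathrm{k}$ with $k=|\mathrm{k}|=k_0+\cdots+k_p\ge1$, let $\overrightarrow{\mathrm{k}}=(j_1,\ldots,j_k)$ be the nondecreasing list in which each $\ell\in\{0,\ldots,p\}$ appears $k_\ell$ times; $\mathcal{P}_{\mathrm{k}}=\frac{1}{k!}\sum z_{i_1}z_{i_2}\cdots z_{i_k}$, the sum running over all the distinct permutations $(i_1,\ldots,i_k)$ of $\overrightarrow{\mathrm{k}}$ (the sum does not depend on the way the products are associated, the same way being used in all terms; e.g. take $(\cdots((z_{i_1}z_{i_2})z_{i_3})\cdots)z_{i_k}$); $\mathcal{P}_{\mathbf{0}}=1$.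 *)

theory Defs
  imports "HOL-Analysis.Analysis" "HOL-Combinatorics.Multiset_Permutations"
begin

section \<open>Octonions\<close>

text \<open>
  The underlying real vector space is \<open>real ^ 8\<close>.  The index type \<open>8\<close> is the type of integers
  modulo 8, so \<open>of_nat i\<close> for \<open>i \<le> 7\<close> runs through all indices.  Since multiplication and \<open>1\<close> on
  \<open>real ^ 8\<close> are the componentwise ones, the octonion product has its own notation and the octonion
  unit is written \<open>\<ee> 0\<close>.
\<close>

type_synonym octonion = "real ^ 8"

definition oct_coord :: "octonion \<Rightarrow> nat \<Rightarrow> real" where
  "oct_coord x i = x $ of_nat i"

definition oct_basis :: "nat \<Rightarrow> octonion" ("\<ee>") where
  "\<ee> i = axis (of_nat i) 1"

definition eps_triples :: "(nat \<times> nat \<times> nat) set" where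
  "eps_triples = {(1,2,3), (1,4,5), (2,4,6), (3,4,7), (5,3,6), (6,1,7), (7,2,5)}"

text \<open>The totally antisymmetric symbol: \<open>1\<close> on even and \<open>-1\<close> on odd permutations of the triples.\<close>

definition oct_eps :: "nat \<Rightarrow> nat \<Rightarrow> nat \<Rightarrow> real" where
  "oct_eps i j k =
     (if (i,j,k) \<in> eps_triples \<or> (j,k,i) \<in> eps_triples \<or> (k,i,j) \<in> eps_triples then 1
      else if (j,i,k) \<in> eps_triples \<or> (i,k,j) \<in> eps_triples \<or> (k,j,i) \<in> eps_triples then - 1
      else 0)"

definition oct_basis_mult :: "nat \<Rightarrow> nat \<Rightarrow> octonion" where
  "oct_basis_mult i j =
     (if i = 0 then \<ee> j else if j = 0 then \<ee> i
      else (if i = j then - \<ee> 0 else 0) + (\<Sum>k = 1..7. oct_eps i j k *\<^sub>R \<ee> k))"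

definition oct_mult :: "octonion \<Rightarrow> octonion \<Rightarrow> octonion" (infixl "\<odot>" 70) where
  "x \<odot> y = (\<Sum>i\<le>7. \<Sum>j\<le>7. (oct_coord x i * oct_coord y j) *\<^sub>R oct_basis_mult i j)"

lemma oct_index_bij: "bij_betw of_nat {..7::nat} (UNIV :: 8 set)"
proof -
  have "y \<in> of_nat ` {..7::nat}" for y :: 8
  proof (cases y)
    case (of_int z)
    then have "y = of_nat (nat z)" "nat z \<le> 7" by auto
    then show ?thesis by blast
  qed
  then have surj: "of_nat ` {..7::nat} = (UNIV :: 8 set)" by blast
  have "inj_on (of_nat :: nat \<Rightarrow> 8) {..7}"
    by (rule eq_card_imp_inj_on) (simp_all add: surj)
  with surj show ?thesis by (simp add: bij_betw_def)
qed

lemma oct_index_inj: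
  assumes "i \<le> 7" "j \<le> 7" "(of_nat i :: 8) = of_nat j"
  shows "i = j"
  using assms oct_index_bij by (auto simp: bij_betw_def inj_on_def)

lemma oct_coord_basis:
  assumes "i \<le> 7" "j \<le> 7"
  shows "oct_coord (\<ee> i) j = (if i = j then 1 else 0)"
  using oct_index_inj[OF assms] by (auto simp: oct_coord_def oct_basis_def axis_def)

lemma oct_mult_basis:
  assumes "i \<le> 7" "j \<le> 7"
  shows "\<ee> i \<odot> \<ee> j = oct_basis_mult i j"
proof -
  have "\<ee> i \<odot> \<ee> j =
      (\<Sum>a\<le>7. \<Sum>b\<le>7. if b = j then (if a = i then oct_basis_mult a b else 0) else 0)"
    unfolding oct_mult_def
    by (intro sum.cong refl) (use assms in \<open>auto simp: oct_coord_basis\<close>)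
  also have "\<dots> = oct_basis_mult i j"
    using assms by (simp add: sum.delta)
  finally show ?thesis .
qed

lemma oct_expand: "x = (\<Sum>i\<le>7. oct_coord x i *\<^sub>R \<ee> i)"
proof -
  have "(\<Sum>i\<le>7. oct_coord x i *\<^sub>R \<ee> i) = (\<Sum>i\<in>UNIV. (x $ i) *\<^sub>R (axis i 1 :: octonion))"
    unfolding oct_coord_def oct_basis_def by (rule sum.reindex_bij_betw[OF oct_index_bij])
  also have "\<dots> = x" by (simp add: vec_eq_iff axis_def if_distrib cong: if_cong)
  finally show ?thesis by simp
qed

lemma oct_coord_sum_basis:
  assumes "A \<subseteq> {..7}" "j \<le> 7"
  shows "oct_coord (\<Sum>i\<in>A. a i *\<^sub>R \<ee> i) j = (if j \<in> A then a j else 0)"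
proof -
  have fin: "finite A" using assms(1) finite_subset by blast
  have "oct_coord (\<Sum>i\<in>A. a i *\<^sub>R \<ee> i) j = (\<Sum>i\<in>A. a i * oct_coord (\<ee> i) j)"
    by (simp add: oct_coord_def)
  also have "\<dots> = (\<Sum>i\<in>A. if i = j then a i else 0)"
    by (intro sum.cong refl) (use assms in \<open>auto simp: oct_coord_basis\<close>)
  also have "\<dots> = (if j \<in> A then a j else 0)" using fin by simp
  finally show ?thesis .
qed

lemma oct_norm: "(norm (x :: octonion))\<^sup>2 = (\<Sum>i\<le>7. (oct_coord x i)\<^sup>2)"
proof -
  have "(\<Sum>i\<le>7. (oct_coord x i)\<^sup>2) = (\<Sum>i\<in>UNIV. (x $ i)\<^sup>2)"
    unfolding oct_coord_def by (rule sum.reindex_bij_betw[OF oct_index_bij])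
  also have "\<dots> = (norm x)\<^sup>2"
    by (simp add: norm_vec_def L2_set_def sum_nonneg)
  finally show ?thesis by simp
qed

lemma oct_norm_sum_basis:
  assumes "A \<subseteq> {..7}"
  shows "(norm (\<Sum>i\<in>A. a i *\<^sub>R \<ee> i))\<^sup>2 = (\<Sum>i\<in>A. (a i)\<^sup>2)"
proof -
  have "(norm (\<Sum>i\<in>A. a i *\<^sub>R \<ee> i))\<^sup>2 = (\<Sum>i\<le>7. if i \<in> A then (a i)\<^sup>2 else 0)"
    unfolding oct_norm by (intro sum.cong refl) (simp add: oct_coord_sum_basis[OF assms])
  also have "\<dots> = (\<Sum>i\<in>A. (a i)\<^sup>2)"
    using assms by (simp add: sum.If_cases Int_absorb1)
  finally show ?thesis .
qed


section \<open>The decomposition of an octonion\<close>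

definition paravec_space :: "nat \<Rightarrow> octonion set" where
  "paravec_space p = span (\<ee> ` {..p})"

definition oct_sphere :: "nat \<Rightarrow> octonion set" where
  "oct_sphere p = {(\<Sum>i = p+1..7. a i *\<^sub>R \<ee> i) | a :: nat \<Rightarrow> real. (\<Sum>i = p+1..7. (a i)\<^sup>2) = 1}"

definition paravec_part :: "nat \<Rightarrow> octonion \<Rightarrow> octonion" where
  "paravec_part p x = (\<Sum>i\<le>p. oct_coord x i *\<^sub>R \<ee> i)"

definition oct_radius :: "nat \<Rightarrow> octonion \<Rightarrow> real" where
  "oct_radius p x = norm (x - paravec_part p x)"

text \<open>
  For \<open>oct_radius p x = 0\<close> the unit vector in the decomposition is arbitrary and we choose
  \<open>\<ee> (p + 1)\<close>.  The lemmas \<open>CK_ext_eq\<close> and \<open>fueter_var_eq\<close> below show that nothing depends on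
  this choice.
\<close>

definition oct_direction :: "nat \<Rightarrow> octonion \<Rightarrow> octonion" where
  "oct_direction p x =
     (if oct_radius p x = 0 then \<ee> (p + 1)
      else (1 / oct_radius p x) *\<^sub>R (x - paravec_part p x))"

lemma paravec_complement:
  assumes "p \<le> 6"
  shows "x - paravec_part p x = (\<Sum>i = p+1..7. oct_coord x i *\<^sub>R \<ee> i)"
proof -
  have split: "{..7} = {..p} \<union> {p+1..7::nat}" "{..p} \<inter> {p+1..7::nat} = {}" using assms by auto
  have "x = (\<Sum>i\<in>{..p} \<union> {p+1..7}. oct_coord x i *\<^sub>R \<ee> i)"
    using oct_expand[of x] unfolding split(1) .
  also have "\<dots> = paravec_part p x + (\<Sum>i = p+1..7. oct_coord x i *\<^sub>R \<ee> i)"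
    unfolding paravec_part_def by (rule sum.union_disjoint) (use split in auto)
  finally show ?thesis by (simp add: algebra_simps)
qed

lemma paravec_part_add: "paravec_part p (x + y) = paravec_part p x + paravec_part p y"
  by (simp add: paravec_part_def oct_coord_def sum.distrib scaleR_left_distrib)

lemma paravec_part_scaleR: "paravec_part p (c *\<^sub>R x) = c *\<^sub>R paravec_part p x"
  by (simp add: paravec_part_def oct_coord_def scaleR_sum_right)

lemma paravec_part_basis:
  assumes "i \<le> p" "p \<le> 6"
  shows "paravec_part p (\<ee> i) = \<ee> i"
proof -
  have "paravec_part p (\<ee> i) = (\<Sum>j\<le>p. if j = i then \<ee> i else 0)"
    unfolding paravec_part_def
    by (intro sum.cong refl) (use assms in \<open>auto simp: oct_coord_basis\<close>)
  then show ?thesis using assms by simp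
qed

lemma paravec_part_id:
  assumes "p \<le> 6" "y \<in> paravec_space p"
  shows "paravec_part p y = y"
  using assms(2) unfolding paravec_space_def
  by (induction rule: span_induct_alt)
     (auto simp: paravec_part_add paravec_part_scaleR paravec_part_basis assms(1),
      simp add: paravec_part_def oct_coord_def)

lemma oct_decomposition:
  assumes "p \<le> 6"
  shows "paravec_part p x \<in> paravec_space p" "oct_radius p x \<ge> 0" "oct_direction p x \<in> oct_sphere p"
    "x = paravec_part p x + oct_radius p x *\<^sub>R oct_direction p x"
proof -
  let ?r = "oct_radius p x"
  show "paravec_part p x \<in> paravec_space p"
    unfolding paravec_part_def paravec_space_def
    by (intro span_sum span_scale span_base) auto
  show "?r \<ge> 0" by (simp add: oct_radius_def)
  show "x = paravec_part p x + ?r *\<^sub>R oct_direction p x"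
    by (auto simp: oct_direction_def oct_radius_def)
  show "oct_direction p x \<in> oct_sphere p"
  proof (cases "?r = 0")
    case True
    define a where "a i = (if i = p + 1 then 1 else 0 :: real)" for i
    have "(\<Sum>i = p+1..7. a i *\<^sub>R \<ee> i) = (\<Sum>i = p+1..7. if i = p+1 then \<ee> i else 0)"
      unfolding a_def by (intro sum.cong) auto
    also have "\<dots> = \<ee> (p + 1)" using assms by simp
    finally have 1: "\<ee> (p + 1) = (\<Sum>i = p+1..7. a i *\<^sub>R \<ee> i)" by simp
    have "(\<Sum>i = p+1..7. (a i)\<^sup>2) = (\<Sum>i = p+1..7. if i = p+1 then 1 else 0)"
      unfolding a_def by (intro sum.cong) auto
    also have "\<dots> = 1" using assms by simp
    finally show ?thesis using True 1 unfolding oct_direction_def oct_sphere_def by auto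
  next
    case False
    define a where "a i = oct_coord x i / ?r" for i
    have 1: "oct_direction p x = (\<Sum>i = p+1..7. a i *\<^sub>R \<ee> i)"
      using False unfolding oct_direction_def paravec_complement[OF assms]
      by (simp add: scaleR_sum_right a_def)
    have "?r\<^sup>2 = (\<Sum>i = p+1..7. (oct_coord x i)\<^sup>2)"
      unfolding oct_radius_def paravec_complement[OF assms]
      by (rule oct_norm_sum_basis) auto
    then have "(\<Sum>i = p+1..7. (a i)\<^sup>2) = 1"
      using False by (simp add: a_def power_divide flip: sum_divide_distrib) (metis zero_eq_power2)
    with 1 show ?thesis unfolding oct_sphere_def by blast
  qed
qed

lemma oct_decomposition_unique:
  assumes "p \<le> 6" "y \<in> paravec_space p" "r \<ge> 0" "w \<in> oct_sphere p"
  shows "paravec_part p (y + r *\<^sub>R w) = y" "oct_radius p (y + r *\<^sub>R w) = r"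
    "r > 0 \<Longrightarrow> oct_direction p (y + r *\<^sub>R w) = w"
proof -
  obtain a :: "nat \<Rightarrow> real" where w: "w = (\<Sum>i = p+1..7. a i *\<^sub>R \<ee> i)"
    and a: "(\<Sum>i = p+1..7. (a i)\<^sup>2) = 1"
    using assms(4) unfolding oct_sphere_def by blast
  have "paravec_part p w = 0"
    unfolding paravec_part_def w
    by (intro sum.neutral ballI) (use assms(1) in \<open>auto simp: oct_coord_sum_basis\<close>)
  then show 1: "paravec_part p (y + r *\<^sub>R w) = y"
    using paravec_part_id[OF assms(1,2)] by (simp add: paravec_part_add paravec_part_scaleR)
  have "(norm w)\<^sup>2 = 1"
    unfolding w a[symmetric] by (rule oct_norm_sum_basis) auto
  then have "norm w = 1" by (simp add: power2_eq_1_iff) (use norm_ge_zero[of w] in linarith)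
  then show 2: "oct_radius p (y + r *\<^sub>R w) = r"
    using assms(3) by (simp add: oct_radius_def 1)
  show "oct_direction p (y + r *\<^sub>R w) = w" if "r > 0"
    using that by (simp add: oct_direction_def 1 2)
qed


section \<open>The CK-extension\<close>

text \<open>
  A function on the paravector space is represented by a function on all octonions.  At a point \<open>y\<close>
  of \<open>paravec_space p\<close>, the operators below only use the values of \<open>f\<close> on \<open>paravec_space p\<close>.
\<close>

definition oct_partial :: "nat \<Rightarrow> (octonion \<Rightarrow> octonion) \<Rightarrow> octonion \<Rightarrow> octonion" where
  "oct_partial i f y = vector_derivative (\<lambda>t. f (y + t *\<^sub>R \<ee> i)) (at 0)"

definition oct_dirac :: "nat \<Rightarrow> (octonion \<Rightarrow> octonion) \<Rightarrow> octonion \<Rightarrow> octonion" where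
  "oct_dirac p f y = (\<Sum>i\<le>p. \<ee> i \<odot> oct_partial i f y)"

definition oct_laplace :: "nat \<Rightarrow> (octonion \<Rightarrow> octonion) \<Rightarrow> octonion \<Rightarrow> octonion" where
  "oct_laplace p f y = (\<Sum>i\<le>p. oct_partial i (oct_partial i f) y)"

definition neg_laplace_pow :: "nat \<Rightarrow> nat \<Rightarrow> (octonion \<Rightarrow> octonion) \<Rightarrow> octonion \<Rightarrow> octonion" where
  "neg_laplace_pow p n f = ((\<lambda>g y. - oct_laplace p g y) ^^ n) f"

definition CK_formula ::
  "nat \<Rightarrow> (octonion \<Rightarrow> octonion) \<Rightarrow> octonion \<Rightarrow> real \<Rightarrow> octonion \<Rightarrow> octonion" where
  "CK_formula p f y r w =
     (\<Sum>n. (r ^ (2*n) / fact (2*n)) *\<^sub>R neg_laplace_pow p n f y)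
     + w \<odot> (\<Sum>n. (r ^ (2*n+1) / fact (2*n+1)) *\<^sub>R neg_laplace_pow p n (oct_dirac p f) y)"

definition CK_ext :: "nat \<Rightarrow> (octonion \<Rightarrow> octonion) \<Rightarrow> octonion \<Rightarrow> octonion" where
  "CK_ext p f x = CK_formula p f (paravec_part p x) (oct_radius p x) (oct_direction p x)"

lemma CK_ext_eq:
  assumes "p \<le> 6" "y \<in> paravec_space p" "r \<ge> 0" "w \<in> oct_sphere p"
  shows "CK_ext p f (y + r *\<^sub>R w) = CK_formula p f y r w"
proof (cases "r = 0")
  case True
  have "oct_mult v 0 = 0" for v by (simp add: oct_mult_def oct_coord_def)
  then show ?thesis
    using True oct_decomposition_unique[OF assms] by (simp add: CK_ext_def CK_formula_def)
next
  case False
  then show ?thesis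
    using assms(3) oct_decomposition_unique[OF assms] by (simp add: CK_ext_def)
qed


section \<open>The two families of polynomials\<close>

text \<open>
  A multi-index is a function \<open>k :: nat \<Rightarrow> nat\<close>, of which only the values \<open>k 0, \<dots>, k p\<close> are used.
\<close>

definition monomial_fun :: "nat \<Rightarrow> (nat \<Rightarrow> nat) \<Rightarrow> octonion \<Rightarrow> octonion" where
  "monomial_fun p k y = (\<Prod>i\<le>p. oct_coord y i ^ k i) *\<^sub>R \<ee> 0"

definition CK_poly :: "nat \<Rightarrow> (nat \<Rightarrow> nat) \<Rightarrow> octonion \<Rightarrow> octonion" where
  "CK_poly p k x = (1 / (\<Prod>i\<le>p. fact (k i))) *\<^sub>R CK_ext p (monomial_fun p k) x"

definition fueter_var :: "nat \<Rightarrow> nat \<Rightarrow> octonion \<Rightarrow> octonion" where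
  "fueter_var p l x =
     oct_coord (paravec_part p x) l *\<^sub>R \<ee> 0 + oct_radius p x *\<^sub>R (oct_direction p x \<odot> \<ee> l)"

lemma fueter_var_eq:
  assumes "p \<le> 6" "y \<in> paravec_space p" "r \<ge> 0" "w \<in> oct_sphere p"
  shows "fueter_var p l (y + r *\<^sub>R w) = oct_coord y l *\<^sub>R \<ee> 0 + r *\<^sub>R (w \<odot> \<ee> l)"
  using oct_decomposition_unique[OF assms] assms(3)
  by (cases "r = 0") (simp_all add: fueter_var_def)

definition index_list :: "nat \<Rightarrow> (nat \<Rightarrow> nat) \<Rightarrow> nat list" where
  "index_list p k = concat (map (\<lambda>l. replicate (k l) l) [0..<p+1])"

text \<open>Products are associated to the left; starting with the unit makes the empty product \<open>\<ee> 0\<close>.\<close>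

definition oct_prod_list :: "octonion list \<Rightarrow> octonion" where
  "oct_prod_list zs = foldl (\<odot>) (\<ee> 0) zs"

definition fueter_poly :: "nat \<Rightarrow> (nat \<Rightarrow> nat) \<Rightarrow> octonion \<Rightarrow> octonion" where
  "fueter_poly p k x =
     (1 / fact (\<Sum>i\<le>p. k i)) *\<^sub>R
     (\<Sum>js \<in> permutations_of_multiset (mset (index_list p k)).
        oct_prod_list (map (\<lambda>l. fueter_var p l x) js))"

end

theory Submission
  imports Defs
begin

text \<open>
  Both families solve the same recursion, which removes the last factor of the products.

  Fix \<open>x = y + r \<omega>\<close>, write \<open>t\<^sub>l\<close> for the coordinates of \<open>y\<close> and \<open>u\<^sub>l = \<omega> e\<^sub>l\<close>, so that the
  Fueter variables are \<open>z\<^sub>l = t\<^sub>l + r u\<^sub>l\<close>.  Let \<open>\<epsilon>\<^sub>l\<close> be the \<open>l\<close>-th unit multi-index and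
  \<open>n = |k|\<close>.  Grouping the permutations of the index list by their last letter, the sum \<open>S\<^sub>k\<close> of
  the left-associated products satisfies \<open>S\<^sub>k = (\<Sum>l. S\<^bsub>k - \<epsilon>\<^sub>l\<^esub> z\<^sub>l)\<close>.  It thus suffices that
  \<open>n V\<^sub>k = (\<Sum>l. V\<^bsub>k - \<epsilon>\<^sub>l\<^esub> z\<^sub>l)\<close> for the CK-extensions \<open>V\<^sub>k\<close> of the divided monomials
  \<open>t\<^sup>k / k!\<close>, since then \<open>S\<^sub>k = n! V\<^sub>k\<close> by induction on \<open>n\<close>
  (\<open>sum_permutations_eq_CK_divided\<close>).

  The partial derivatives of divided monomials are again divided monomials, hence
  \<open>V\<^sub>k = A\<^sub>k + (\<Sum>i. B\<^bsub>k - \<epsilon>\<^sub>i\<^esub> u\<^sub>i)\<close> with real polynomials \<open>A\<^sub>k\<close> and \<open>B\<^sub>k\<close> in \<open>t\<close> and \<open>r\<close>.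
  Expanding the right-hand side of the recursion leaves products \<open>u\<^sub>i u\<^sub>l\<close> with the coefficients
  \<open>B\<^bsub>k - \<epsilon>\<^sub>i - \<epsilon>\<^sub>l\<^esub>\<close>, which are symmetric in \<open>i\<close> and \<open>l\<close>; only the anticommutators matter.  These are
  \<open>u\<^sub>i u\<^sub>l + u\<^sub>l u\<^sub>i = - 2 \<delta>\<^sub>i\<^sub>l\<close> (\<open>oct_anticommutator\<close>), because \<open>u\<^sub>i\<close> is imaginary and left
  multiplication by the unit vector \<open>\<omega>\<close> is an isometry.  What remains are two real identities
  (\<open>CK_even_euler\<close>, \<open>CK_odd_euler\<close>), namely Euler's relations for \<open>A\<^sub>k\<close> and \<open>B\<^sub>k\<close>, which are
  homogeneous of degree \<open>n\<close> and \<open>n + 1\<close> in \<open>(t, r)\<close>.  The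
  non-associativity of the octonions does no harm, because every \<open>V\<^sub>k\<close> lies in the real span of \<open>1\<close> and
  the \<open>u\<^sub>i\<close>, so that the recursion only involves products of two of the \<open>u\<^sub>i\<close>.
\<close>

section \<open>The octonion product\<close>

lemma oct_mult_bounded_bilinear: "bounded_bilinear (\<odot>)"
proof -
  have "bilinear (\<odot>)"
    unfolding bilinear_def
    by (auto intro!: linearI simp: oct_mult_def oct_coord_def algebra_simps sum.distrib scaleR_sum_right)
  then show ?thesis by (simp add: bilinear_conv_bounded_bilinear)
qed

interpretation oct: bounded_bilinear "(\<odot>)"
  by (rule oct_mult_bounded_bilinear)

lemma atMost_7: "{..7::nat} = {0,1,2,3,4,5,6,7}"
  by auto

lemma oct_basis_mult_0 [simp]: "oct_basis_mult 0 j = \<ee> j" "oct_basis_mult i 0 = \<ee> i"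
  by (simp_all add: oct_basis_mult_def)

lemma oct_mult_unit [simp]: "\<ee> 0 \<odot> x = x" "x \<odot> \<ee> 0 = x"
proof -
  have "\<ee> 0 \<odot> (\<Sum>i\<le>7. oct_coord x i *\<^sub>R \<ee> i) = (\<Sum>i\<le>7. oct_coord x i *\<^sub>R \<ee> i)"
    unfolding oct.sum_right by (intro sum.cong refl) (simp add: oct.scaleR_right oct_mult_basis)
  then show "\<ee> 0 \<odot> x = x" by (simp flip: oct_expand)
  have "(\<Sum>i\<le>7. oct_coord x i *\<^sub>R \<ee> i) \<odot> \<ee> 0 = (\<Sum>i\<le>7. oct_coord x i *\<^sub>R \<ee> i)"
    unfolding oct.sum_left by (intro sum.cong refl) (simp add: oct.scaleR_left oct_mult_basis)
  then show "x \<odot> \<ee> 0 = x" by (simp flip: oct_expand)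
qed

lemma oct_coord_linear [simp]:
  "oct_coord (x + y) i = oct_coord x i + oct_coord y i"
  "oct_coord (- x) i = - oct_coord x i"
  "oct_coord (c *\<^sub>R x) i = c * oct_coord x i"
  "oct_coord 0 i = 0"
  "oct_coord (sum f A) i = (\<Sum>a\<in>A. oct_coord (f a) i)"
  by (simp_all add: oct_coord_def)

lemma oct_eqI:
  assumes "\<And>i. i \<le> 7 \<Longrightarrow> oct_coord x i = oct_coord y i"
  shows "x = y"
  using assms by (subst oct_expand[of x], subst oct_expand[of y]) simp

lemma oct_coord_basis_mult:
  assumes "i \<in> {1..7}" "j \<in> {1..7}" "n \<le> 7"
  shows "oct_coord (oct_basis_mult i j) n =
    (if n = 0 then (if i = j then - 1 else 0) else oct_eps i j n)"
proof -
  have "oct_coord (\<Sum>k = 1..7. oct_eps i j k *\<^sub>R \<ee> k) n = (if n \<in> {1..7} then oct_eps i j n else 0)"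
    by (rule oct_coord_sum_basis) (use assms in auto)
  then show ?thesis
    using assms by (auto simp: oct_basis_mult_def oct_coord_basis simp del: oct_coord_linear(5))
qed

lemma oct_coord_mult:
  assumes "n \<le> 7"
  shows "oct_coord (x \<odot> y) n =
    (\<Sum>i\<le>7. \<Sum>j\<le>7. oct_coord x i * oct_coord y j * oct_coord (oct_basis_mult i j) n)"
  by (simp add: oct_mult_def)

text \<open>
  The product in coordinates.  For \<open>n \<ge> 1\<close> the antisymmetric part of the \<open>n\<close>-th coordinate collects the
  three triples that contain \<open>n\<close>, read cyclically.
\<close>

lemma oct_coord_mult_explicit:
  fixes x y :: octonion
  defines "a \<equiv> oct_coord x" and "b \<equiv> oct_coord y"
  shows
  "oct_coord (x \<odot> y) 0 = a 0*b 0 - a 1*b 1 - a 2*b 2 - a 3*b 3 - a 4*b 4 - a 5*b 5 - a 6*b 6 - a 7*b 7"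
  "oct_coord (x \<odot> y) 1 = a 0*b 1 + a 1*b 0 + (a 2*b 3 - a 3*b 2) + (a 4*b 5 - a 5*b 4) + (a 7*b 6 - a 6*b 7)"
  "oct_coord (x \<odot> y) 2 = a 0*b 2 + a 2*b 0 + (a 3*b 1 - a 1*b 3) + (a 4*b 6 - a 6*b 4) + (a 5*b 7 - a 7*b 5)"
  "oct_coord (x \<odot> y) 3 = a 0*b 3 + a 3*b 0 + (a 1*b 2 - a 2*b 1) + (a 4*b 7 - a 7*b 4) + (a 6*b 5 - a 5*b 6)"
  "oct_coord (x \<odot> y) 4 = a 0*b 4 + a 4*b 0 + (a 5*b 1 - a 1*b 5) + (a 6*b 2 - a 2*b 6) + (a 7*b 3 - a 3*b 7)"
  "oct_coord (x \<odot> y) 5 = a 0*b 5 + a 5*b 0 + (a 1*b 4 - a 4*b 1) + (a 3*b 6 - a 6*b 3) + (a 7*b 2 - a 2*b 7)"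
  "oct_coord (x \<odot> y) 6 = a 0*b 6 + a 6*b 0 + (a 2*b 4 - a 4*b 2) + (a 5*b 3 - a 3*b 5) + (a 1*b 7 - a 7*b 1)"
  "oct_coord (x \<odot> y) 7 = a 0*b 7 + a 7*b 0 + (a 3*b 4 - a 4*b 3) + (a 2*b 5 - a 5*b 2) + (a 6*b 1 - a 1*b 6)"
  unfolding a_def b_def
  by (simp_all add: oct_coord_mult atMost_7 oct_coord_basis_mult oct_coord_basis oct_eps_def eps_triples_def)

text \<open>
  The octonions form a composition algebra.  In coordinates this is Degen's eight-square identity,
  which holds by expansion.
\<close>

lemma oct_norm_mult: "norm (x \<odot> y) = norm x * norm (y :: octonion)"
proof -
  have "(norm (x \<odot> y))\<^sup>2 = (norm x)\<^sup>2 * (norm y)\<^sup>2"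
    unfolding oct_norm atMost_7
    by (simp add: oct_coord_mult_explicit[simplified]) (simp add: power2_eq_square algebra_simps)
  then show ?thesis
    by (metis norm_ge_zero power2_eq_imp_eq power_mult_distrib mult_nonneg_nonneg)
qed

text \<open>In \<open>u \<odot> u\<close> the antisymmetric part of the product cancels.\<close>

lemma oct_square_imaginary:
  assumes "oct_coord u 0 = 0"
  shows "u \<odot> u = - (norm u)\<^sup>2 *\<^sub>R \<ee> 0"
proof (rule oct_eqI)
  fix i :: nat assume "i \<le> 7"
  then have "i \<in> {0,1,2,3,4,5,6,7}" by auto
  then show "oct_coord (u \<odot> u) i = oct_coord (- (norm u)\<^sup>2 *\<^sub>R \<ee> 0) i"
    unfolding oct_norm atMost_7 using assms
    by (auto simp: oct_coord_mult_explicit[simplified] oct_coord_basis power2_eq_square)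
qed

text \<open>
  The unit vector \<open>w\<close> is
  orthogonal to all \<open>\<ee> i\<close> with \<open>i \<le> p\<close>.  Hence \<open>w \<odot> a\<close> is imaginary for a paravector \<open>a\<close>, and it has the
  norm of \<open>a\<close>, so that its square is \<open>- (norm a)\<^sup>2\<close>.  Polarizing this quadratic identity, with
  \<open>a = \<ee> l + \<ee> m\<close>, gives the anticommutators.
\<close>

lemma oct_anticommutator:
  assumes "p \<le> 6" "w \<in> oct_sphere p" "l \<le> p" "m \<le> p"
  shows "(w \<odot> \<ee> l) \<odot> (w \<odot> \<ee> m) + (w \<odot> \<ee> m) \<odot> (w \<odot> \<ee> l) = (if l = m then - 2 else 0) *\<^sub>R \<ee> 0"
proof -
  obtain a :: "nat \<Rightarrow> real" where w: "w = (\<Sum>i = p+1..7. a i *\<^sub>R \<ee> i)"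
    and a: "(\<Sum>i = p+1..7. (a i)\<^sup>2) = 1"
    using assms(2) unfolding oct_sphere_def by blast
  have w0: "oct_coord w i = 0" if "i \<le> p" for i
    unfolding w using that assms(1) by (subst oct_coord_sum_basis) auto
  have "(norm w)\<^sup>2 = 1"
    unfolding w a[symmetric] by (rule oct_norm_sum_basis) auto
  then have norm_w: "norm w = 1" by (simp add: power2_eq_1_iff) (use norm_ge_zero[of w] in linarith)
  have imaginary: "oct_coord (w \<odot> \<ee> i) 0 = 0" if "i \<le> p" for i
  proof -
    have "i \<in> {0,1,2,3,4,5,6}" using that assms(1) by auto
    then show ?thesis using w0[OF that] by (auto simp: oct_coord_mult_explicit oct_coord_basis)
  qed
  have norm_basis: "(norm (\<ee> i))\<^sup>2 = 1" if "i \<le> p" for i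
    using oct_norm_sum_basis[of "{i}" "\<lambda>_. 1"] that assms(1) by simp
  have square: "(w \<odot> \<ee> i) \<odot> (w \<odot> \<ee> i) = - \<ee> 0" if "i \<le> p" for i
    using oct_square_imaginary[OF imaginary[OF that]] norm_basis[OF that]
    by (simp add: oct_norm_mult norm_w)
  show ?thesis
  proof (cases "l = m")
    case True
    then show ?thesis using square[OF assms(3)] by (simp add: vec_eq_iff)
  next
    case False
    define u where "u i = w \<odot> \<ee> i" for i
    have "(u l + u m) \<odot> (u l + u m) = - (norm (w \<odot> (\<ee> l + \<ee> m)))\<^sup>2 *\<^sub>R \<ee> 0"
      using oct_square_imaginary[of "u l + u m"] imaginary assms(3,4)
      by (simp add: u_def oct.add_right)
    also have "(norm (w \<odot> (\<ee> l + \<ee> m)))\<^sup>2 = 2"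
      using oct_norm_sum_basis[of "{l,m}" "\<lambda>_. 1"] assms False by (simp add: oct_norm_mult norm_w)
    finally have "(u l + u m) \<odot> (u l + u m) = - \<ee> 0 - \<ee> 0" by (simp add: scaleR_2)
    then show ?thesis
      using square assms(3,4) False by (simp add: u_def oct.add_left oct.add_right algebra_simps)
  qed
qed

section \<open>Iterated Laplacians of divided monomials\<close>

text \<open>
  Divided powers \<open>t\<^sup>n / n!\<close>, extended by zero to negative exponents.  With this convention
  differentiation lowers the exponent by one in all cases, and the recursions below need no guards
  on the exponents.
\<close>

definition divided_power :: "real \<Rightarrow> int \<Rightarrow> real" where
  "divided_power t n = (if n < 0 then 0 else t ^ nat n / fact (nat n))"

lemma divided_power_step: "t * divided_power t (n - 1) = of_int n * divided_power t n"
proof (cases "n > 0")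
  case True
  then obtain m where "n = int (Suc m)" by (metis gr0_implies_Suc zero_less_imp_eq_int)
  then show ?thesis by (simp add: divided_power_def nat_add_distrib del: of_nat_Suc) (simp add: field_simps)
qed (auto simp: divided_power_def)

lemma has_derivative_divided_power:
  "((\<lambda>t. divided_power t n) has_real_derivative divided_power t (n - 1)) (at t)"
proof (cases "n > 0")
  case True
  then obtain m where n: "n = int (Suc m)" by (metis gr0_implies_Suc zero_less_imp_eq_int)
  have "((\<lambda>t. t ^ Suc m / fact (Suc m)) has_real_derivative t ^ m / fact m) (at t)"
    using DERIV_cdivide[OF DERIV_pow[of "Suc m" t], of "fact (Suc m)"] by (simp del: of_nat_Suc)
  then show ?thesis by (simp add: divided_power_def n nat_add_distrib)
next
  case False
  then have "(\<lambda>t. divided_power t n) = (\<lambda>_. of_bool (n = 0))" "divided_power t (n - 1) = 0"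
    by (auto simp: divided_power_def fun_eq_iff)
  then show ?thesis by simp
qed

definition lower :: "nat \<Rightarrow> (nat \<Rightarrow> int) \<Rightarrow> nat \<Rightarrow> int" where
  "lower l k = k(l := k l - 1)"

lemma lower_commute: "lower i (lower l k) = lower l (lower i k)"
  by (auto simp: lower_def fun_eq_iff)

lemma sum_lower:
  assumes "l \<le> p"
  shows "(\<Sum>i\<le>p. lower l k i) = (\<Sum>i\<le>p. k i) - 1"
proof -
  have "(\<Sum>i\<le>p. lower l k i) = (\<Sum>i\<le>p. k i - (if i = l then 1 else 0))"
    by (intro sum.cong) (auto simp: lower_def)
  then show ?thesis using assms by (simp add: sum_subtractf)
qed

text \<open>
  The value at \<open>t\<close> of the \<open>j\<close>-th power of the negative Laplacian applied to the divided monomial with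
  exponents \<open>k\<close>; \<open>neg_laplace_pow_monomial\<close> establishes the connection with the differential operators.
\<close>

primrec laplace_monomial :: "nat \<Rightarrow> nat \<Rightarrow> (nat \<Rightarrow> int) \<Rightarrow> (nat \<Rightarrow> real) \<Rightarrow> real" where
  "laplace_monomial p 0 k t = (\<Prod>i\<le>p. divided_power (t i) (k i))"
| "laplace_monomial p (Suc j) k t = - (\<Sum>i\<le>p. laplace_monomial p j (lower i (lower i k)) t)"

lemma laplace_monomial_cong:
  "(\<And>i. i \<le> p \<Longrightarrow> k i = k' i) \<Longrightarrow> laplace_monomial p j k t = laplace_monomial p j k' t"
proof (induction j arbitrary: k k')
  case (Suc j)
  have "laplace_monomial p j (lower i (lower i k)) t = laplace_monomial p j (lower i (lower i k')) t" for i
    by (rule Suc.IH) (use Suc.prems in \<open>auto simp: lower_def\<close>)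
  then show ?case by simp
qed simp

lemma laplace_monomial_negative:
  "i \<le> p \<Longrightarrow> k i < 0 \<Longrightarrow> laplace_monomial p j k t = 0"
proof (induction j arbitrary: k)
  case 0
  then show ?case by (auto intro!: bexI[of _ i] simp: divided_power_def)
next
  case (Suc j)
  have "laplace_monomial p j (lower l (lower l k)) t = 0" for l
    by (rule Suc.IH) (use Suc.prems in \<open>auto simp: lower_def\<close>)
  then show ?case by simp
qed

text \<open>Each Laplacian lowers the degree by two.  This makes the series of the CK-extension finite.\<close>

lemma laplace_monomial_vanish:
  "(\<Sum>i\<le>p. k i) < 2 * int j \<Longrightarrow> laplace_monomial p j k t = 0"
proof (induction j arbitrary: k)
  case 0
  then have "\<not> (\<forall>i\<in>{..p}. 0 \<le> k i)" using sum_nonneg[of "{..p}" k] by fastforce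
  then obtain i where "i \<le> p" "k i < 0" by (auto simp: not_le)
  then show ?case by (rule laplace_monomial_negative)
next
  case (Suc j)
  then show ?case by (simp add: sum_lower)
qed

text \<open>
  Euler's relation for a homogeneous polynomial of degree \<open>|k| - 2 j\<close>, as lowering the exponent of \<open>l\<close>
  is differentiation with respect to \<open>t\<^sub>l\<close>.
\<close>

lemma laplace_monomial_euler:
  "(\<Sum>l\<le>p. t l * laplace_monomial p j (lower l k) t)
    = (of_int (\<Sum>i\<le>p. k i) - 2 * real j) * laplace_monomial p j k t"
proof (induction j arbitrary: k)
  case 0
  have "t l * laplace_monomial p 0 (lower l k) t = of_int (k l) * laplace_monomial p 0 k t"
    if "l \<le> p" for l
  proof -
    have rest: "(\<Prod>i\<in>{..p}-{l}. divided_power (t i) (lower l k i)) = (\<Prod>i\<in>{..p}-{l}. divided_power (t i) (k i))"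
      by (intro prod.cong) (auto simp: lower_def)
    have "laplace_monomial p 0 k' t = divided_power (t l) (k' l) * (\<Prod>i\<in>{..p}-{l}. divided_power (t i) (k' i))" for k'
      using that by (simp add: prod.remove)
    then show ?thesis
      using divided_power_step[of "t l" "k l"] unfolding rest
      by (simp add: rest lower_def[of l k] del: laplace_monomial.simps)
  qed
  then show ?case by (simp add: sum_distrib_right del: laplace_monomial.simps)
next
  case (Suc j)
  have "(\<Sum>l\<le>p. t l * laplace_monomial p (Suc j) (lower l k) t)
      = - (\<Sum>l\<le>p. \<Sum>i\<le>p. t l * laplace_monomial p j (lower l (lower i (lower i k))) t)"
    by (simp add: sum_distrib_left sum_negf lower_commute[of _ l for l])
  also have "\<dots> = - (\<Sum>i\<le>p. \<Sum>l\<le>p. t l * laplace_monomial p j (lower l (lower i (lower i k))) t)"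
    by (subst sum.swap) simp
  also have "\<dots> = - (\<Sum>i\<le>p. (of_int (\<Sum>i\<le>p. k i) - 2 * real (Suc j)) * laplace_monomial p j (lower i (lower i k)) t)"
    unfolding Suc.IH by (intro arg_cong[of _ _ uminus] sum.cong refl) (simp add: sum_lower)
  also have "\<dots> = (of_int (\<Sum>i\<le>p. k i) - 2 * real (Suc j)) * laplace_monomial p (Suc j) k t"
    by (simp add: sum_distrib_left)
  finally show ?case .
qed

lemma has_derivative_laplace_monomial:
  assumes "p \<le> 6" "l \<le> p"
  shows "((\<lambda>t. laplace_monomial p j k (oct_coord (y + t *\<^sub>R \<ee> l)))
    has_real_derivative laplace_monomial p j (lower l k) (oct_coord y)) (at 0)"
proof (induction j arbitrary: k)
  case 0
  have split: "laplace_monomial p 0 k' s = divided_power (s l) (k' l) * (\<Prod>i\<in>{..p}-{l}. divided_power (s i) (k' i))" for k' s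
    using assms by (simp add: prod.remove)
  have rest: "(\<Prod>i\<in>{..p}-{l}. divided_power (oct_coord (y + t *\<^sub>R \<ee> l) i) (k i))
      = (\<Prod>i\<in>{..p}-{l}. divided_power (oct_coord y i) (k i))" for t
    using assms by (intro prod.cong) (auto simp: oct_coord_basis)
  have rest': "(\<Prod>i\<in>{..p}-{l}. divided_power (oct_coord y i) (lower l k i))
      = (\<Prod>i\<in>{..p}-{l}. divided_power (oct_coord y i) (k i))"
    by (intro prod.cong) (auto simp: lower_def)
  have "((\<lambda>t. divided_power (oct_coord y l + t) (k l)) has_real_derivative
      divided_power (oct_coord y l) (k l - 1) * 1) (at 0)"
    by (rule DERIV_chain2[where f = "\<lambda>t. divided_power t (k l)"])
       (auto intro!: derivative_eq_intros simp: has_derivative_divided_power)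
  from DERIV_cmult_right[OF this] show ?case
    unfolding split rest rest' using assms by (simp add: lower_def oct_coord_basis)
next
  case (Suc j)
  have "((\<lambda>t. - (\<Sum>i\<le>p. laplace_monomial p j (lower i (lower i k)) (oct_coord (y + t *\<^sub>R \<ee> l))))
    has_real_derivative - (\<Sum>i\<le>p. laplace_monomial p j (lower l (lower i (lower i k))) (oct_coord y))) (at 0)"
    by (intro DERIV_minus DERIV_sum Suc.IH)
  then show ?case by (simp add: lower_commute[of _ l] del: oct_coord_linear)
qed

text \<open>
  Sums with octonion coefficients are needed because the Dirac operator turns a real monomial into
  such a sum.
\<close>

lemma oct_partial_laplace_monomial:
  assumes "p \<le> 6" "l \<le> p"
  shows "oct_partial l (\<lambda>y. \<Sum>i\<in>I. laplace_monomial p j (K i) (oct_coord y) *\<^sub>R c i)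
    = (\<lambda>y. \<Sum>i\<in>I. laplace_monomial p j (lower l (K i)) (oct_coord y) *\<^sub>R c i)"
proof
  fix y
  have "((\<lambda>t. \<Sum>i\<in>I. laplace_monomial p j (K i) (oct_coord (y + t *\<^sub>R \<ee> l)) *\<^sub>R c i) has_vector_derivative
      (\<Sum>i\<in>I. laplace_monomial p j (lower l (K i)) (oct_coord y) *\<^sub>R c i)) (at 0)"
  proof (intro has_vector_derivative_sum)
    fix i
    show "((\<lambda>t. laplace_monomial p j (K i) (oct_coord (y + t *\<^sub>R \<ee> l)) *\<^sub>R c i) has_vector_derivative
      laplace_monomial p j (lower l (K i)) (oct_coord y) *\<^sub>R c i) (at 0)"
      using has_vector_derivative_scaleR[OF has_derivative_laplace_monomial[OF assms, of j "K i" y]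
          has_vector_derivative_const[of "c i"]] by simp
  qed
  then show "oct_partial l (\<lambda>y. \<Sum>i\<in>I. laplace_monomial p j (K i) (oct_coord y) *\<^sub>R c i) y
    = (\<Sum>i\<in>I. laplace_monomial p j (lower l (K i)) (oct_coord y) *\<^sub>R c i)"
    unfolding oct_partial_def by (rule vector_derivative_at)
qed

lemma neg_laplace_pow_monomial:
  assumes "p \<le> 6"
  shows "neg_laplace_pow p n (\<lambda>y. \<Sum>i\<in>I. laplace_monomial p 0 (K i) (oct_coord y) *\<^sub>R c i)
    = (\<lambda>y. \<Sum>i\<in>I. laplace_monomial p n (K i) (oct_coord y) *\<^sub>R c i)"
proof (induction n)
  case 0
  then show ?case by (simp add: neg_laplace_pow_def)
next
  case (Suc n)
  let ?F = "\<lambda>n y. \<Sum>i\<in>I. laplace_monomial p n (K i) (oct_coord y) *\<^sub>R c i"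
  have "neg_laplace_pow p (Suc n) (?F 0) = (\<lambda>y. - oct_laplace p (?F n) y)"
    using Suc.IH by (simp add: neg_laplace_pow_def)
  also have "\<dots> = ?F (Suc n)"
  proof
    fix y
    have "oct_laplace p (?F n) y
        = (\<Sum>l\<le>p. \<Sum>i\<in>I. laplace_monomial p n (lower l (lower l (K i))) (oct_coord y) *\<^sub>R c i)"
      unfolding oct_laplace_def
      by (intro sum.cong refl) (simp add: oct_partial_laplace_monomial[OF assms])
    also have "\<dots> = (\<Sum>i\<in>I. \<Sum>l\<le>p. laplace_monomial p n (lower l (lower l (K i))) (oct_coord y) *\<^sub>R c i)"
      by (rule sum.swap)
    finally show "- oct_laplace p (?F n) y = ?F (Suc n) y"
      by (simp add: scaleR_sum_left sum_negf)
  qed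
  finally show ?case .
qed

section \<open>Recursion for the CK-extension\<close>

lemma summable_laplace_monomial:
  "summable (\<lambda>j. f j * laplace_monomial p j k t)"
proof (rule summable_finite[of "{.. nat (\<Sum>i\<le>p. k i)}"])
  fix j assume "j \<notin> {.. nat (\<Sum>i\<le>p. k i)}"
  then have "(\<Sum>i\<le>p. k i) < 2 * int j" by auto
  then show "f j * laplace_monomial p j k t = 0" by (simp add: laplace_monomial_vanish)
qed simp

definition CK_even :: "nat \<Rightarrow> (nat \<Rightarrow> int) \<Rightarrow> (nat \<Rightarrow> real) \<Rightarrow> real \<Rightarrow> real" where
  "CK_even p k t r = (\<Sum>j. r ^ (2*j) / fact (2*j) * laplace_monomial p j k t)"

definition CK_odd :: "nat \<Rightarrow> (nat \<Rightarrow> int) \<Rightarrow> (nat \<Rightarrow> real) \<Rightarrow> real \<Rightarrow> real" where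
  "CK_odd p k t r = (\<Sum>j. r ^ (2*j+1) / fact (2*j+1) * laplace_monomial p j k t)"

lemma CK_sums:
  "(\<lambda>j. r ^ (2*j) / fact (2*j) * laplace_monomial p j k t) sums CK_even p k t r"
  "(\<lambda>j. r ^ (2*j+1) / fact (2*j+1) * laplace_monomial p j k t) sums CK_odd p k t r"
  unfolding CK_even_def CK_odd_def by (intro summable_sums summable_laplace_monomial)+

text \<open>
  Euler's relation in the variables \<open>(t, r)\<close>: the sum of \<open>CK_odd\<close> with its sign is the derivative of
  \<open>CK_even\<close> with respect to \<open>r\<close>, since differentiating \<open>r\<^bsup>2j\<^esup> / (2j)!\<close> shifts the series by one
  Laplacian.
\<close>

lemma CK_even_euler:
  "of_int (\<Sum>i\<le>p. k i) * CK_even p k t r =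
    (\<Sum>l\<le>p. t l * CK_even p (lower l k) t r) - r * (\<Sum>l\<le>p. CK_odd p (lower l (lower l k)) t r)"
proof -
  let ?n = "of_int (\<Sum>i\<le>p. k i) :: real"
  define c where "c j = r ^ (2*j) / fact (2*j)" for j
  define d where "d j = r ^ (2*j+1) / fact (2*j+1)" for j
  have "(\<lambda>j. \<Sum>l\<le>p. d j * laplace_monomial p j (lower l (lower l k)) t) sums
      (\<Sum>l\<le>p. CK_odd p (lower l (lower l k)) t r)"
    unfolding d_def by (intro sums_sum CK_sums)
  from sums_minus[OF this]
  have "(\<lambda>j. d j * laplace_monomial p (Suc j) k t) sums (- (\<Sum>l\<le>p. CK_odd p (lower l (lower l k)) t r))"
    by (simp add: sum_distrib_left)
  then have "(\<lambda>j. r * (d j * laplace_monomial p (Suc j) k t)) sums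
      (r * (- (\<Sum>l\<le>p. CK_odd p (lower l (lower l k)) t r)))"
    by (rule sums_mult)
  also have "(\<lambda>j. r * (d j * laplace_monomial p (Suc j) k t)) =
      (\<lambda>j. 2 * real (Suc j) * c (Suc j) * laplace_monomial p (Suc j) k t)"
  proof
    fix j
    have "fact (2 * Suc j) = 2 * real (Suc j) * (fact (2*j+1) :: real)"
      by (simp add: algebra_simps)
    then have "2 * real (Suc j) * c (Suc j) = r * d j"
      by (simp add: c_def d_def power_add field_simps del: fact_Suc of_nat_Suc)
    then show "r * (d j * laplace_monomial p (Suc j) k t) =
        2 * real (Suc j) * c (Suc j) * laplace_monomial p (Suc j) k t"
      by (simp only: mult.assoc)
  qed
  \<comment> \<open>The term for \<open>j = 0\<close> is zero, so the index can be shifted back.\<close>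
  finally have radial: "(\<lambda>j. 2 * real j * c j * laplace_monomial p j k t) sums
      (- r * (\<Sum>l\<le>p. CK_odd p (lower l (lower l k)) t r))"
    using sums_Suc_iff[of "\<lambda>j. 2 * real j * c j * laplace_monomial p j k t"] by simp
  have "(\<lambda>j. \<Sum>l\<le>p. t l * (c j * laplace_monomial p j (lower l k) t)) sums
      (\<Sum>l\<le>p. t l * CK_even p (lower l k) t r)"
    unfolding c_def by (intro sums_sum sums_mult CK_sums)
  also have "(\<lambda>j. \<Sum>l\<le>p. t l * (c j * laplace_monomial p j (lower l k) t)) =
      (\<lambda>j. c j * ((?n - 2 * real j) * laplace_monomial p j k t))"
    unfolding laplace_monomial_euler[symmetric] by (simp add: sum_distrib_left mult.left_commute)
  finally have "(\<lambda>j. c j * ((?n - 2 * real j) * laplace_monomial p j k t)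
      + 2 * real j * c j * laplace_monomial p j k t) sums
      ((\<Sum>l\<le>p. t l * CK_even p (lower l k) t r) + - r * (\<Sum>l\<le>p. CK_odd p (lower l (lower l k)) t r))"
    using radial by (rule sums_add)
  also have "(\<lambda>j. c j * ((?n - 2 * real j) * laplace_monomial p j k t)
      + 2 * real j * c j * laplace_monomial p j k t) = (\<lambda>j. ?n * (c j * laplace_monomial p j k t))"
    by (simp add: algebra_simps)
  finally show ?thesis
    using sums_unique2[OF sums_mult[OF CK_sums(1), of ?n r p k t]] by (simp add: c_def)
qed

text \<open>
  Euler's relation for degree \<open>|k| + 1\<close>; here the derivative with respect to \<open>r\<close> is \<open>CK_even\<close>,
  without a shift of the series.
\<close>

lemma CK_odd_euler:
  "(of_int (\<Sum>i\<le>p. k i) + 1) * CK_odd p k t r =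
    r * CK_even p k t r + (\<Sum>l\<le>p. t l * CK_odd p (lower l k) t r)"
proof -
  let ?n = "of_int (\<Sum>i\<le>p. k i) :: real"
  define c where "c j = r ^ (2*j) / fact (2*j)" for j
  define d where "d j = r ^ (2*j+1) / fact (2*j+1)" for j
  have d: "(2 * real j + 1) * d j = r * c j" for j
  proof -
    define a where "a = 2 * real j + 1"
    have "a \<noteq> 0" "fact (2*j+1) = a * (fact (2*j) :: real)" by (simp_all add: a_def)
    then show ?thesis unfolding c_def d_def a_def[symmetric] by (simp del: fact_Suc)
  qed
  have "(\<lambda>j. \<Sum>l\<le>p. t l * (d j * laplace_monomial p j (lower l k) t)) sums
      (\<Sum>l\<le>p. t l * CK_odd p (lower l k) t r)"
    unfolding d_def by (intro sums_sum sums_mult CK_sums)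
  also have "(\<lambda>j. \<Sum>l\<le>p. t l * (d j * laplace_monomial p j (lower l k) t)) =
      (\<lambda>j. d j * ((?n - 2 * real j) * laplace_monomial p j k t))"
    unfolding laplace_monomial_euler[symmetric] by (simp add: sum_distrib_left mult.left_commute)
  finally have "(\<lambda>j. r * (c j * laplace_monomial p j k t)
       + d j * ((?n - 2 * real j) * laplace_monomial p j k t)) sums
      (r * CK_even p k t r + (\<Sum>l\<le>p. t l * CK_odd p (lower l k) t r))"
    unfolding c_def by (intro sums_add sums_mult CK_sums)
  also have "(\<lambda>j. r * (c j * laplace_monomial p j k t)
       + d j * ((?n - 2 * real j) * laplace_monomial p j k t)) =
      (\<lambda>j. (?n + 1) * (d j * laplace_monomial p j k t))"
  proof
    fix j
    have "r * (c j * laplace_monomial p j k t) = (2 * real j + 1) * d j * laplace_monomial p j k t"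
      unfolding d by simp
    then show "r * (c j * laplace_monomial p j k t) + d j * ((?n - 2 * real j) * laplace_monomial p j k t)
        = (?n + 1) * (d j * laplace_monomial p j k t)"
      by (simp only:) (simp add: algebra_simps del: of_int_sum)
  qed
  finally show ?thesis
    using sums_unique2[OF sums_mult[OF CK_sums(2), of "?n + 1" r p k t]] by (simp add: d_def)
qed

text \<open>
  The CK-extension of a divided monomial at \<open>y + r \<omega>\<close>, where \<open>t\<close> are the coordinates of \<open>y\<close> and \<open>u i\<close>
  stands for \<open>\<omega> e\<^sub>i\<close> (see \<open>CK_poly_eq_CK_divided\<close>).  Leaving \<open>u\<close> abstract shows that
  the recursion depends on its anticommutators only.
\<close>

definition CK_divided ::
  "nat \<Rightarrow> (nat \<Rightarrow> int) \<Rightarrow> (nat \<Rightarrow> real) \<Rightarrow> real \<Rightarrow> (nat \<Rightarrow> octonion) \<Rightarrow> octonion" where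
  "CK_divided p k t r u = CK_even p k t r *\<^sub>R \<ee> 0 + (\<Sum>i\<le>p. CK_odd p (lower i k) t r *\<^sub>R u i)"

text \<open>As \<open>b\<close> is symmetric, swapping \<open>i\<close> and \<open>l\<close> shows that twice the sum is a sum of anticommutators.\<close>

lemma sum_symmetric_anticommuting:
  fixes p :: nat
  assumes "\<And>i l. i \<le> p \<Longrightarrow> l \<le> p \<Longrightarrow> u i \<odot> u l + u l \<odot> u i = (if i = l then - 2 else 0) *\<^sub>R \<ee> 0"
  assumes "\<And>i l. b i l = b l i"
  shows "(\<Sum>l\<le>p. \<Sum>i\<le>p. b i l *\<^sub>R (u i \<odot> u l)) = - (\<Sum>l\<le>p. b l l) *\<^sub>R \<ee> 0"
proof -
  let ?S = "\<Sum>l\<le>p. \<Sum>i\<le>p. b i l *\<^sub>R (u i \<odot> u l)"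
  have "?S = (\<Sum>l\<le>p. \<Sum>i\<le>p. b i l *\<^sub>R (u l \<odot> u i))"
    by (subst sum.swap) (simp add: assms(2))
  then have "?S + ?S = (\<Sum>l\<le>p. \<Sum>i\<le>p. b i l *\<^sub>R (u i \<odot> u l + u l \<odot> u i))"
    by (simp add: sum.distrib scaleR_add_right)
  also have "\<dots> = (\<Sum>l\<le>p. \<Sum>i\<le>p. if i = l then (- 2 * b l l) *\<^sub>R \<ee> 0 else 0)"
    by (intro sum.cong refl) (auto simp: assms(1))
  also have "\<dots> = (\<Sum>l\<le>p. (- 2 * b l l) *\<^sub>R \<ee> 0)"
    by (rule sum.cong) (simp_all only: sum.delta finite_atMost if_True)
  also have "\<dots> = 2 *\<^sub>R (- (\<Sum>l\<le>p. b l l) *\<^sub>R \<ee> 0)"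
    by (simp add: sum_negf sum_distrib_left flip: scaleR_sum_left)
  finally have "2 *\<^sub>R ?S = 2 *\<^sub>R (- (\<Sum>l\<le>p. b l l) *\<^sub>R \<ee> 0)" by (simp add: scaleR_2)
  then show ?thesis by (simp only: scaleR_cancel_left) simp
qed

text \<open>
  After expanding the products, the coefficient of \<open>\<ee> 0\<close> is \<open>CK_even_euler\<close>, and the coefficient of
  \<open>u i\<close> is \<open>CK_odd_euler\<close> for the exponents \<open>lower i k\<close>, whose sum is smaller by one.
\<close>

lemma CK_divided_recursion:
  assumes "\<And>i l. i \<le> p \<Longrightarrow> l \<le> p \<Longrightarrow> u i \<odot> u l + u l \<odot> u i = (if i = l then - 2 else 0) *\<^sub>R \<ee> 0"
  shows "of_int (\<Sum>i\<le>p. k i) *\<^sub>R CK_divided p k t r u =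
    (\<Sum>l\<le>p. CK_divided p (lower l k) t r u \<odot> (t l *\<^sub>R \<ee> 0 + r *\<^sub>R u l))"
proof -
  let ?n = "of_int (\<Sum>i\<le>p. k i) :: real"
  define A where "A l = CK_even p (lower l k) t r" for l
  define B where "B i l = CK_odd p (lower i (lower l k)) t r" for i l
  have swap: "(\<Sum>l\<le>p. \<Sum>i\<le>p. (t l * B i l) *\<^sub>R u i) = (\<Sum>i\<le>p. (\<Sum>l\<le>p. t l * B i l) *\<^sub>R u i)"
    by (subst sum.swap) (simp add: scaleR_sum_left)
  have B_sym: "B i l = B l i" for i l by (simp add: B_def lower_commute)
  have "(\<Sum>l\<le>p. CK_divided p (lower l k) t r u \<odot> (t l *\<^sub>R \<ee> 0 + r *\<^sub>R u l)) =
     (\<Sum>l\<le>p. (t l * A l) *\<^sub>R \<ee> 0 + (r * A l) *\<^sub>R u l + (\<Sum>i\<le>p. (t l * B i l) *\<^sub>R u i)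
       + r *\<^sub>R (\<Sum>i\<le>p. B i l *\<^sub>R (u i \<odot> u l)))"
    by (intro sum.cong refl)
       (simp add: CK_divided_def A_def B_def oct.add_left oct.add_right oct.scaleR_left oct.scaleR_right
         oct.sum_left scaleR_sum_right scaleR_add_right mult.commute)
  also have "\<dots> = (\<Sum>l\<le>p. t l * A l) *\<^sub>R \<ee> 0 + (\<Sum>i\<le>p. (r * A i) *\<^sub>R u i)
      + (\<Sum>i\<le>p. (\<Sum>l\<le>p. t l * B i l) *\<^sub>R u i) + r *\<^sub>R (\<Sum>l\<le>p. \<Sum>i\<le>p. B i l *\<^sub>R (u i \<odot> u l))"
    by (simp add: sum.distrib swap flip: scaleR_sum_left scaleR_sum_right)
  also have "\<dots> = (\<Sum>l\<le>p. t l * A l) *\<^sub>R \<ee> 0 + (\<Sum>i\<le>p. (r * A i) *\<^sub>R u i)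
      + (\<Sum>i\<le>p. (\<Sum>l\<le>p. t l * B i l) *\<^sub>R u i) - (r * (\<Sum>l\<le>p. B l l)) *\<^sub>R \<ee> 0"
    by (simp add: sum_symmetric_anticommuting[OF assms B_sym])
  also have "\<dots> = ((\<Sum>l\<le>p. t l * A l) - r * (\<Sum>l\<le>p. B l l)) *\<^sub>R \<ee> 0
      + (\<Sum>i\<le>p. (r * A i + (\<Sum>l\<le>p. t l * B i l)) *\<^sub>R u i)"
    by (simp add: scaleR_left_distrib scaleR_left_diff_distrib sum.distrib)
  also have "(\<Sum>l\<le>p. t l * A l) - r * (\<Sum>l\<le>p. B l l) = ?n * CK_even p k t r"
    using CK_even_euler[of k p t r] by (simp add: A_def B_def)
  also have "(\<Sum>i\<le>p. (r * A i + (\<Sum>l\<le>p. t l * B i l)) *\<^sub>R u i)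
      = (\<Sum>i\<le>p. (?n * CK_odd p (lower i k) t r) *\<^sub>R u i)"
  proof (intro sum.cong refl arg_cong2[of _ _ _ _ scaleR])
    fix i assume "i \<in> {..p}"
    then have "of_int (\<Sum>l\<le>p. lower i k l) + 1 = ?n" by (simp add: sum_lower)
    then show "r * A i + (\<Sum>l\<le>p. t l * B i l) = ?n * CK_odd p (lower i k) t r"
      using CK_odd_euler[of "lower i k" p t r] by (simp add: A_def B_def lower_commute)
  qed
  finally show ?thesis
    by (simp add: CK_divided_def scaleR_add_right scaleR_sum_right)
qed

lemma CK_divided_cong:
  assumes "\<And>i. i \<le> p \<Longrightarrow> k i = k' i"
  shows "CK_divided p k t r u = CK_divided p k' t r u"
proof -
  have "laplace_monomial p j k t = laplace_monomial p j k' t" for j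
    by (rule laplace_monomial_cong) (rule assms)
  moreover have "laplace_monomial p j (lower i k) t = laplace_monomial p j (lower i k') t" for i j
    by (rule laplace_monomial_cong) (auto simp: lower_def assms)
  ultimately show ?thesis by (simp add: CK_divided_def CK_even_def CK_odd_def)
qed

lemma CK_divided_negative:
  assumes "l \<le> p" "k l < 0"
  shows "CK_divided p k t r u = 0"
proof -
  have "lower i k l < 0" for i using assms by (auto simp: lower_def)
  then show ?thesis
    using assms by (simp add: CK_divided_def CK_even_def CK_odd_def laplace_monomial_negative[of l])
qed

lemma CK_divided_0: "CK_divided p (\<lambda>_. 0) t r u = \<ee> 0"
proof -
  have "laplace_monomial p j (\<lambda>_. 0) t = (if j = 0 then 1 else 0)" for j
    by (cases "j = 0") (auto simp: divided_power_def intro!: laplace_monomial_vanish)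
  then have "(\<lambda>j. r ^ (2*j) / fact (2*j) * laplace_monomial p j (\<lambda>_. 0) t) = (\<lambda>j. if j = 0 then 1 else 0)"
    by auto
  then have "CK_even p (\<lambda>_. 0) t r = 1"
    using CK_sums(1)[of r p "\<lambda>_. 0" t] sums_single[of 0 "\<lambda>_. 1::real"] sums_unique2 by fastforce
  moreover have "CK_odd p (lower i (\<lambda>_. 0)) t r = 0" if "i \<le> p" for i
    using that by (simp add: CK_odd_def laplace_monomial_negative[of i] lower_def)
  ultimately show ?thesis by (simp add: CK_divided_def)
qed

text \<open>
  The constant \<open>C = k!\<close> turns the monomial into a divided one.  The \<open>i\<close>-th summand of the Dirac
  operator lowers the \<open>i\<close>-th exponent, which is where \<open>lower i k\<close> in \<open>CK_divided\<close> comes from.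
\<close>

lemma CK_poly_eq_CK_divided:
  assumes "p \<le> 6"
  shows "CK_poly p k x = CK_divided p (\<lambda>i. int (k i)) (oct_coord (paravec_part p x)) (oct_radius p x)
    (\<lambda>i. oct_direction p x \<odot> \<ee> i)"
proof -
  define C :: real where "C = (\<Prod>i\<le>p. fact (k i))"
  define y where "y = paravec_part p x"
  define r where "r = oct_radius p x"
  define w where "w = oct_direction p x"
  define \<kappa> where "\<kappa> = (\<lambda>i. int (k i))"
  have C: "C \<noteq> 0" by (simp add: C_def)
  \<comment> \<open>Written as a sum over one index, the form to which \<open>neg_laplace_pow_monomial\<close> applies.\<close>
  have f: "monomial_fun p k = (\<lambda>y. \<Sum>i\<in>{0::nat}. laplace_monomial p 0 \<kappa> (oct_coord y) *\<^sub>R (C *\<^sub>R \<ee> 0))"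
    by (simp add: fun_eq_iff monomial_fun_def \<kappa>_def C_def divided_power_def prod_dividef)
  have D: "oct_dirac p (monomial_fun p k)
      = (\<lambda>y. \<Sum>i\<le>p. laplace_monomial p 0 (lower i \<kappa>) (oct_coord y) *\<^sub>R (C *\<^sub>R \<ee> i))"
    unfolding f oct_dirac_def
    by (intro ext sum.cong refl, subst oct_partial_laplace_monomial[OF assms])
       (simp_all add: oct.scaleR_right del: laplace_monomial.simps)
  have even: "(\<lambda>n. (r ^ (2*n) / fact (2*n)) *\<^sub>R neg_laplace_pow p n (monomial_fun p k) y) sums
      (CK_even p \<kappa> (oct_coord y) r *\<^sub>R (C *\<^sub>R \<ee> 0))"
    unfolding f neg_laplace_pow_monomial[OF assms]
    using sums_scaleR_left[OF CK_sums(1)[of r p \<kappa> "oct_coord y"], of "C *\<^sub>R \<ee> 0"] by (simp add: mult.assoc)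
  have "(\<lambda>n. \<Sum>i\<le>p. (r ^ (2*n+1) / fact (2*n+1) * laplace_monomial p n (lower i \<kappa>) (oct_coord y)) *\<^sub>R (C *\<^sub>R \<ee> i)) sums
      (\<Sum>i\<le>p. CK_odd p (lower i \<kappa>) (oct_coord y) r *\<^sub>R (C *\<^sub>R \<ee> i))"
    by (intro sums_sum sums_scaleR_left CK_sums)
  then have odd: "(\<lambda>n. (r ^ (2*n+1) / fact (2*n+1)) *\<^sub>R neg_laplace_pow p n (oct_dirac p (monomial_fun p k)) y) sums
      (\<Sum>i\<le>p. CK_odd p (lower i \<kappa>) (oct_coord y) r *\<^sub>R (C *\<^sub>R \<ee> i))"
    unfolding D neg_laplace_pow_monomial[OF assms] by (simp add: scaleR_sum_right mult.assoc)
  have "CK_formula p (monomial_fun p k) y r w = CK_even p \<kappa> (oct_coord y) r *\<^sub>R (C *\<^sub>R \<ee> 0)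
      + w \<odot> (\<Sum>i\<le>p. CK_odd p (lower i \<kappa>) (oct_coord y) r *\<^sub>R (C *\<^sub>R \<ee> i))"
    unfolding CK_formula_def sums_unique[OF even, symmetric] sums_unique[OF odd, symmetric] ..
  also have "\<dots> = C *\<^sub>R CK_divided p \<kappa> (oct_coord y) r (\<lambda>i. w \<odot> \<ee> i)"
    by (simp add: CK_divided_def oct.sum_right oct.scaleR_right scaleR_add_right scaleR_sum_right mult.commute)
  finally show ?thesis
    using C by (simp add: CK_poly_def CK_ext_def y_def r_def w_def C_def \<kappa>_def)
qed

section \<open>Sums over permutations\<close>

lemma oct_prod_list_snoc: "oct_prod_list (zs @ [z]) = oct_prod_list zs \<odot> z"
  by (simp add: oct_prod_list_def)

text \<open>
  Permutations are closed under reversal, so the decomposition by the first letter in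
  \<open>permutations_of_multiset_nonempty\<close> gives one by the last letter.  The last letter is the right
  one for products that are associated to the left.
\<close>

lemma sum_permutations_last:
  assumes "M \<noteq> {#}"
  shows "(\<Sum>js\<in>permutations_of_multiset M. f js) =
    (\<Sum>l\<in>set_mset M. \<Sum>js\<in>permutations_of_multiset (M - {#l#}). f (js @ [l]))"
proof -
  have rev: "(\<Sum>js\<in>permutations_of_multiset N. g (rev js)) = (\<Sum>js\<in>permutations_of_multiset N. g js)" for N :: "'a multiset" and g :: "'a list \<Rightarrow> 'b"
    using sum.reindex[of rev "permutations_of_multiset N" g] by simp
  have "(\<Sum>js\<in>permutations_of_multiset M. f js) = (\<Sum>js\<in>permutations_of_multiset M. f (rev js))"
    by (simp add: rev)
  also have "\<dots> = (\<Sum>l\<in>set_mset M. \<Sum>js\<in>(#) l ` permutations_of_multiset (M - {#l#}). f (rev js))"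
    unfolding permutations_of_multiset_nonempty[OF assms] by (rule sum.UNION_disjoint) auto
  also have "\<dots> = (\<Sum>l\<in>set_mset M. \<Sum>js\<in>permutations_of_multiset (M - {#l#}). f (rev js @ [l]))"
    by (rule sum.cong) (simp_all add: sum.reindex)
  also have "\<dots> = (\<Sum>l\<in>set_mset M. \<Sum>js\<in>permutations_of_multiset (M - {#l#}). f (js @ [l]))"
    by (simp add: rev[where g = "\<lambda>js. f (js @ [l])" for l])
  finally show ?thesis .
qed

text \<open>
  Induction on the size: both sides satisfy the same recursion by \<open>sum_permutations_last\<close> and
  \<open>CK_divided_recursion\<close>.
\<close>

lemma sum_permutations_eq_CK_divided:
  assumes "\<And>i l. i \<le> p \<Longrightarrow> l \<le> p \<Longrightarrow> u i \<odot> u l + u l \<odot> u i = (if i = l then - 2 else 0) *\<^sub>R \<ee> 0"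
  assumes "set_mset M \<subseteq> {..p}"
  shows "(\<Sum>js\<in>permutations_of_multiset M. oct_prod_list (map (\<lambda>l. t l *\<^sub>R \<ee> 0 + r *\<^sub>R u l) js))
    = fact (size M) *\<^sub>R CK_divided p (\<lambda>i. int (count M i)) t r u"
  using assms(2)
proof (induction "size M" arbitrary: M)
  case 0
  then show ?case by (simp add: oct_prod_list_def CK_divided_0)
next
  case (Suc n)
  define z where "z = (\<lambda>l. t l *\<^sub>R \<ee> 0 + r *\<^sub>R u l)"
  define V where "V k = CK_divided p k t r u" for k
  let ?k = "\<lambda>i. int (count M i)"
  have recursion: "of_int (\<Sum>i\<le>p. ?k i) *\<^sub>R V ?k = (\<Sum>l\<le>p. V (lower l ?k) \<odot> z l)"
    unfolding V_def z_def using assms(1) by (rule CK_divided_recursion)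
  have ne: "M \<noteq> {#}" using Suc.hyps(2) by auto
  have remove: "(\<Sum>js\<in>permutations_of_multiset (M - {#l#}). oct_prod_list (map z js)) = fact n *\<^sub>R V (lower l ?k)"
    if "l \<in># M" for l
  proof -
    have "(\<lambda>i. int (count (M - {#l#}) i)) = lower l ?k"
      using that by (auto simp: lower_def fun_eq_iff of_nat_diff Suc_le_eq)
    moreover have "n = size (M - {#l#})" using that Suc.hyps(2) by (simp add: size_Diff_singleton)
    moreover have "set_mset (M - {#l#}) \<subseteq> {..p}" using Suc.prems by (auto dest: in_diffD)
    ultimately show ?thesis using Suc.hyps(1)[of "M - {#l#}"] by (simp add: z_def V_def)
  qed
  have "(\<Sum>js\<in>permutations_of_multiset M. oct_prod_list (map z js)) =
      (\<Sum>l\<in>set_mset M. (\<Sum>js\<in>permutations_of_multiset (M - {#l#}). oct_prod_list (map z js)) \<odot> z l)"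
    by (simp add: sum_permutations_last[OF ne] oct_prod_list_snoc oct.sum_left)
  also have "\<dots> = (\<Sum>l\<in>set_mset M. fact n *\<^sub>R (V (lower l ?k) \<odot> z l))"
    by (intro sum.cong refl) (simp add: remove oct.scaleR_left)
  also have "\<dots> = fact n *\<^sub>R (\<Sum>l\<le>p. V (lower l ?k) \<odot> z l)"
    unfolding scaleR_sum_right
    \<comment> \<open>A letter that does not occur in \<open>M\<close> would get exponent \<open>-1\<close>, and such a term is zero.\<close>
  proof (intro sum.mono_neutral_left ballI)
    fix l assume l: "l \<in> {..p} - set_mset M"
    then have "V (lower l ?k) = 0"
      unfolding V_def by (intro CK_divided_negative[of l]) (auto simp: lower_def not_in_iff)
    then show "fact n *\<^sub>R (V (lower l ?k) \<odot> z l) = 0" by (simp add: oct.zero_left)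
  qed (use Suc.prems in auto)
  also have "\<dots> = fact n *\<^sub>R (of_int (\<Sum>i\<le>p. ?k i) *\<^sub>R V ?k)"
    by (simp only: recursion)
  also have "(\<Sum>i\<le>p. ?k i) = int (Suc n)"
    using Suc.prems by (simp add: Suc.hyps(2) size_multiset_overloaded_eq not_in_iff sum.mono_neutral_left[of "{..p}" "set_mset M"])
  finally show ?case
    unfolding Suc.hyps(2)[symmetric] z_def V_def by (simp add: mult.commute del: of_nat_Suc)
qed

lemma count_index_list: "count (mset (index_list p k)) i = (if i \<le> p then k i else 0)"
proof -
  have "count (mset (concat (map (\<lambda>l. replicate (k l) l) [0..<n]))) i = (if i < n then k i else 0)" for n
    by (induction n) auto
  then show ?thesis by (simp add: index_list_def less_Suc_eq_le del: upt_Suc)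
qed

lemma length_index_list: "length (index_list p k) = (\<Sum>i\<le>p. k i)"
proof -
  have "length (concat (map (\<lambda>l. replicate (k l) l) [0..<n])) = (\<Sum>i<n. k i)" for n
    by (induction n) auto
  then show ?thesis by (simp add: index_list_def lessThan_Suc_atMost del: upt_Suc)
qed

text \<open>
  The factor \<open>1 / n!\<close> in the Fueter polynomials cancels the \<open>n!\<close> of
  \<open>sum_permutations_eq_CK_divided\<close>.
\<close>

theorem theorem6p12:
  fixes p :: nat and k :: "nat \<Rightarrow> nat" and x :: octonion
  assumes "p \<le> 6"
  shows "CK_poly p k x = fueter_poly p k x"
proof -
  let ?M = "mset (index_list p k)"
  let ?t = "oct_coord (paravec_part p x)" and ?r = "oct_radius p x"
  let ?u = "\<lambda>i. oct_direction p x \<odot> \<ee> i"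
  have M: "set_mset ?M \<subseteq> {..p}"
    by (metis count_index_list atMost_iff not_in_iff subsetI)
  have "fueter_poly p k x = CK_divided p (\<lambda>i. int (count ?M i)) ?t ?r ?u"
    using sum_permutations_eq_CK_divided[of p ?u ?M ?t ?r] M
      oct_anticommutator[OF assms oct_decomposition(3)[OF assms]]
    by (simp add: fueter_poly_def fueter_var_def[abs_def] length_index_list)
  also have "\<dots> = CK_divided p (\<lambda>i. int (k i)) ?t ?r ?u"
    by (rule CK_divided_cong) (simp add: count_index_list)
  also have "\<dots> = CK_poly p k x"
    by (simp add: CK_poly_eq_CK_divided[OF assms])
  finally show ?thesis by simp
qed

end
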